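(* Let $f,g\in O_n$ and let $\mathcal T$ be any one of the following sets of directions: $$\{(1,\alpha_l,\beta_l):l=1,\dots,n\},\qquad\{(\alpha_l,1,\beta_l):l=1,\dots,n\},\qquad\{(\alpha_l,\beta_l,1):l=1,\dots,n\},$$ where $|\alpha_l|,|\beta_l|<1$ and, for each $(\xi,\eta)\in\mathbb Z_p^2\setminus\{(0,0)\}$, the set $\{\alpha_l\xi+\beta_l\eta:l=1,\dots,n\}$ has exactly $n$ elements. Suppose that $g_{\mathbf t}=e^{\mathrm i\theta_0}f_{\mathbf t}$ for all $\mathbf t\in\mathcal T$, for some constant $\theta_0\in\mathbb R$ independent of $\mathbf t\in\mathcal T$. Then $g=e^{\mathrm i\theta_0}f$.
   Context: Let $n$ be a positive odd integer, $p=2n-1$, and for odd $m$ let $\mathbb Z_m=\{-(m-1)/2,\dots,(m-1)/2\}$. $O_n$ is the set of all functions $f:\mathbb Z_n^3\to\mathbb C$. Let $D_p(t)=\frac1p\sum_{l\in\mathbb Z_p}e^{\mathrm i2\pi lt/p}$ and, for $f\in O_n$, $\widetilde f(x,y,z)=\sum_{i,j,k\in\mathbb Z_n}f(i,j,k)D_p(x-i)D_p(y-j)D_p(z-k)$ for $x,y,z\in\mathbb R$. The discrete projection $f_{\mathbf t}:\mathbb Z_p^2\to\mathbb C$ in a direction $\mathbf t$ of the form $(1,\alpha,\beta)$, $(\alpha,1,\beta)$ or $(\alpha,\beta,1)$ with $|\alpha|,|\beta|<1$ is, for $(c_1,c_2)\in\mathbb Z_p^2$, $f_{(1,\alpha,\beta)}(c_1,c_2)=\sum_{i\in\mathbb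 Z_n}\widetilde f(i,\alpha i+c_1,\beta i+c_2)$, $f_{(\alpha,1,\beta)}(c_1,c_2)=\sum_{j\in\mathbb Z_n}\widetilde f(\alpha j+c_1,j,\beta j+c_2)$, $f_{(\alpha,\beta,1)}(c_1,c_2)=\sum_{k\in\mathbb Z_n}\widetilde f(\alpha k+c_1,\beta k+c_2,k)$. *)

theory Defs
  imports Complex_Main "HOL-Library.FuncSet"
begin

definition centered_ints :: "nat \<Rightarrow> int set" where
  "centered_ints m = {- ((int m - 1) div 2) .. (int m - 1) div 2}"

definition cube :: "nat \<Rightarrow> (int \<times> int \<times> int) set" where
  "cube n = centered_ints n \<times> centered_ints n \<times> centered_ints n"

text \<open>Functions on a finite grid are extensional: they are \<^term>\<open>undefined\<close> off the
  grid, so equality of elements of \<open>objects n\<close> is equality as functions on the grid.\<close>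

definition objects :: "nat \<Rightarrow> (int \<times> int \<times> int \<Rightarrow> complex) set" where
  "objects n = cube n \<rightarrow>\<^sub>E UNIV"

definition padded :: "nat \<Rightarrow> nat" where
  "padded n = 2 * n - 1"

definition dirichlet_kernel :: "nat \<Rightarrow> real \<Rightarrow> complex" where
  "dirichlet_kernel p t =
     (1 / of_nat p) * (\<Sum>l\<in>centered_ints p. exp (\<i> * of_real (2 * pi * of_int l * t / of_nat p)))"

definition interpolant ::
  "nat \<Rightarrow> (int \<times> int \<times> int \<Rightarrow> complex) \<Rightarrow> real \<Rightarrow> real \<Rightarrow> real \<Rightarrow> complex" where
  "interpolant n f x y z =
     (\<Sum>i\<in>centered_ints n. \<Sum>j\<in>centered_ints n. \<Sum>k\<in>centered_ints n.
        f (i, j, k) * dirichlet_kernel (padded n) (x - of_int i)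
                    * dirichlet_kernel (padded n) (y - of_int j)
                    * dirichlet_kernel (padded n) (z - of_int k))"

definition detector_grid :: "nat \<Rightarrow> (int \<times> int) set" where
  "detector_grid n = centered_ints (padded n) \<times> centered_ints (padded n)"

text \<open>The three cases below are mutually exclusive; directions of no other form have a
  projection, and there the value is left \<^term>\<open>undefined\<close>.\<close>

definition discrete_projection ::
  "nat \<Rightarrow> (int \<times> int \<times> int \<Rightarrow> complex) \<Rightarrow> real \<times> real \<times> real \<Rightarrow> (int \<times> int \<Rightarrow> complex)" where
  "discrete_projection n f = (\<lambda>(t1, t2, t3). \<lambda>(c1, c2)\<in>detector_grid n.
     if t1 = 1 \<and> \<bar>t2\<bar> < 1 \<and> \<bar>t3\<bar> < 1 then
       (\<Sum>i\<in>centered_ints n.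
          interpolant n f (of_int i) (t2 * of_int i + of_int c1) (t3 * of_int i + of_int c2))
     else if t2 = 1 \<and> \<bar>t1\<bar> < 1 \<and> \<bar>t3\<bar> < 1 then
       (\<Sum>j\<in>centered_ints n.
          interpolant n f (t1 * of_int j + of_int c1) (of_int j) (t3 * of_int j + of_int c2))
     else if t3 = 1 \<and> \<bar>t1\<bar> < 1 \<and> \<bar>t2\<bar> < 1 then
       (\<Sum>k\<in>centered_ints n.
          interpolant n f (t1 * of_int k + of_int c1) (t2 * of_int k + of_int c2) (of_int k))
     else undefined)"

end

theory Submission
  imports Defs "HOL-Computational_Algebra.Polynomial"
begin

text \<open>
  Put \<open>h = g - e\<^sup>i\<^sup>\<theta> f\<close>, so that all projections of \<open>h\<close> vanish. A discrete Fourier transform in the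
  detector variables gives \<open>\<Sum>i. e((\<alpha>\<^sub>l \<xi> + \<beta>\<^sub>l \<eta>) i) H\<^sub>i(\<xi>, \<eta>) = 0\<close> for all \<open>l\<close>, where
  \<open>e(t) = exp(2 \<pi> \<i> t / p)\<close> and \<open>H\<^sub>i\<close> is the transform of the slice \<open>h(i, \<cdot>, \<cdot>)\<close>. The \<open>n\<close> nodes
  \<open>e(\<alpha>\<^sub>l \<xi> + \<beta>\<^sub>l \<eta>)\<close> may coincide for large frequencies although the numbers
  \<open>\<alpha>\<^sub>l \<xi> + \<beta>\<^sub>l \<eta>\<close> differ, since these are only distinct as reals and not modulo \<open>p\<close>. They are
  distinct if \<open>0 < \<bar>\<xi>\<bar> + \<bar>\<eta>\<bar> < n\<close>, and then \<open>H\<^sub>i(\<xi>, \<eta>) = 0\<close> because a nonzero polynomial of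
  degree less than \<open>n\<close> has fewer than \<open>n\<close> roots. These frequencies contain \<open>n\<close> rows \<open>\<xi> = const\<close> with
  at least \<open>n\<close> points each (the row \<open>\<xi> = 0\<close> has \<open>2n - 2\<close>, without the origin), so counting roots
  twice more yields \<open>h = 0\<close> if \<open>n > 1\<close>.
\<close>

section \<open>Additive characters of period \<open>p\<close> and their injectivity\<close>

definition phase :: "nat \<Rightarrow> real \<Rightarrow> complex" where
  "phase p t = cis (2 * pi * t / real p)"

lemma phase_0 [simp]: "phase p 0 = 1"
  by (simp add: phase_def)

lemma phase_add: "phase p (s + t) = phase p s * phase p t"
  by (simp add: phase_def cis_mult add_divide_distrib distrib_left)

lemma phase_nonzero [simp]: "phase p t \<noteq> 0"
  by (simp add: phase_def)

lemma phase_of_nat_mult: "phase p (of_nat k * t) = phase p t ^ k"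
  by (simp add: phase_def DeMoivre mult_ac)

lemma phase_period: "p > 0 \<Longrightarrow> phase p (of_int k * real p) = 1"
  using cis_multiple_2pi[of "of_int k"] by (simp add: phase_def mult.assoc)

text \<open>The value 1 makes \<open>t\<close> an integer multiple of the period \<open>p\<close>,
  and 0 is the only such multiple strictly between \<open>-p\<close> and \<open>p\<close>.\<close>

lemma phase_eq_1_imp:
  assumes "p > 0" "\<bar>t\<bar> < real p" "phase p t = 1"
  shows "t = 0"
proof -
  have "cos (2 * pi * t / real p) = 1"
    using assms(3) by (simp add: phase_def complex_eq_iff)
  then obtain k :: int where "2 * pi * t / real p = k * 2 * pi"
    by (auto simp: cos_one_2pi_int)
  then have t: "t = k * real p"
    using assms(1) by (simp add: field_simps)
  then have "\<bar>real_of_int k\<bar> < 1"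
    using assms(1,2) by (simp add: abs_mult)
  then have "k = 0"
    by linarith
  with t show ?thesis by simp
qed

text \<open>Equal values have quotient \<open>phase p (s - t) = 1\<close>, so bounding the pairwise
  differences is what rules out wrap-around modulo \<open>p\<close>.\<close>

lemma inj_on_phase:
  assumes "p > 0" "\<And>s t. s \<in> S \<Longrightarrow> t \<in> S \<Longrightarrow> \<bar>s - t\<bar> < real p"
  shows "inj_on (phase p) S"
proof (rule inj_onI)
  fix s t assume st: "s \<in> S" "t \<in> S" "phase p s = phase p t"
  have "phase p (s - t) * phase p t = phase p t"
    using st(3) phase_add[of p "s - t" t] by simp
  then have "phase p (s - t) = 1"
    by simp
  with phase_eq_1_imp[OF assms(1) assms(2)[OF st(1,2)]] show "s = t"
    by simp
qed

section \<open>The Dirichlet kernel and its discrete Fourier transform\<close>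

lemma dirichlet_kernel_phase:
  "dirichlet_kernel p t = (\<Sum>l\<in>centered_ints p. phase p (of_int l * t)) / of_nat p"
  by (simp add: dirichlet_kernel_def phase_def cis_conv_exp mult_ac)

lemma centered_ints_odd: "centered_ints (2 * m + 1) = {- int m..int m}"
  by (simp add: centered_ints_def)

lemma sum_centered_ints:
  "(\<Sum>i\<in>centered_ints (2 * m + 1). F i) = (\<Sum>k<2 * m + 1. F (int k - int m))"
  unfolding centered_ints_odd
  by (rule sum.reindex_bij_witness[of _ "\<lambda>k. int k - int m" "\<lambda>i. nat (i + int m)"]) auto

lemma finite_centered_ints [simp]: "finite (centered_ints m)"
  by (simp add: centered_ints_def)

text \<open>Orthogonality of characters: for nonzero \<open>k\<close> the sum is geometric, and its
  ratio is a \<open>p\<close>-th root of unity that differs from 1 because |k| < p.\<close>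

lemma sum_phase_centered:
  assumes "odd p" "\<bar>k\<bar> < int p"
  shows "(\<Sum>l\<in>centered_ints p. phase p (of_int (l * k))) = (if k = 0 then of_nat p else 0)"
proof -
  obtain m where p: "p = 2 * m + 1"
    using assms(1) oddE by blast
  show ?thesis
  proof (cases "k = 0")
    case True
    have "card (centered_ints p) = p"
      unfolding p centered_ints_odd by simp
    with True show ?thesis by simp
  next
    case False
    define w where "w = phase p (of_int k)"
    have "\<bar>real_of_int k\<bar> < real p"
      using assms(2) by linarith
    then have w: "w \<noteq> 1"
      using phase_eq_1_imp[OF odd_pos[OF assms(1)], of "of_int k"] False by (auto simp: w_def)
    have wp: "w ^ p = 1"
      unfolding w_def phase_of_nat_mult[symmetric] using phase_period[of p k] p
      by (simp add: mult.commute)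
    \<comment> \<open>The term for \<open>l = - m\<close> is factored out, which leaves the powers
      of \<open>w\<close> from 0 to \<open>p - 1\<close>.\<close>
    have "(\<Sum>l\<in>centered_ints p. phase p (of_int (l * k)))
        = (\<Sum>j<p. phase p (- real m * of_int k) * w ^ j)"
      unfolding p sum_centered_ints
      by (rule sum.cong) (simp_all add: w_def p flip: phase_of_nat_mult phase_add,
          simp add: algebra_simps)
    also have "\<dots> = phase p (- real m * of_int k) * ((w ^ p - 1) / (w - 1))"
      using w by (simp add: sum_distrib_left[symmetric] geometric_sum)
    finally show ?thesis
      using wp False by simp
  qed
qed

lemma dirichlet_kernel_of_int:
  assumes "odd p" "\<bar>k\<bar> < int p"
  shows "dirichlet_kernel p (of_int k) = (if k = 0 then 1 else 0)"
  using sum_phase_centered[OF assms] odd_pos[OF assms(1)]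
  by (simp add: dirichlet_kernel_phase)

text \<open>After the kernel is expanded into characters, orthogonality in \<open>c\<close> leaves
  only the term \<open>l = \<xi>\<close>. A real shift \<open>x\<close> of the kernel thus turns
  into a phase factor.\<close>

lemma dft_dirichlet_kernel:
  assumes "odd p" "\<xi> \<in> centered_ints p"
  shows "(\<Sum>c\<in>centered_ints p. dirichlet_kernel p (x + of_int c) * phase p (- of_int (\<xi> * c)))
       = phase p (of_int \<xi> * x)"
proof -
  obtain m where p: "p = 2 * m + 1"
    using assms(1) oddE by blast
  have "(\<Sum>c\<in>centered_ints p. dirichlet_kernel p (x + of_int c) * phase p (- of_int (\<xi> * c)))
      = (\<Sum>c\<in>centered_ints p. \<Sum>l\<in>centered_ints p.
           phase p (of_int l * x) * phase p (of_int (c * (l - \<xi>))) / of_nat p)"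
    by (rule sum.cong[OF refl])
      (simp add: dirichlet_kernel_phase sum_distrib_right sum_divide_distrib flip: phase_add,
       simp add: algebra_simps)
  also have "\<dots> = (\<Sum>l\<in>centered_ints p. phase p (of_int l * x) *
                 (\<Sum>c\<in>centered_ints p. phase p (of_int (c * (l - \<xi>)))) / of_nat p)"
    by (subst sum.swap) (simp add: sum_distrib_left sum_divide_distrib)
  also have "\<dots> = (\<Sum>l\<in>centered_ints p. if l = \<xi> then phase p (of_int \<xi> * x) else 0)"
  proof (rule sum.cong[OF refl])
    fix l assume "l \<in> centered_ints p"
    then have "\<bar>l - \<xi>\<bar> < int p"
      using assms(2) unfolding p centered_ints_odd by auto
    then show "phase p (of_int l * x) *
        (\<Sum>c\<in>centered_ints p. phase p (of_int (c * (l - \<xi>)))) / of_nat p =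
        (if l = \<xi> then phase p (of_int \<xi> * x) else 0)"
      using sum_phase_centered[OF assms(1), of "l - \<xi>"] odd_pos[OF assms(1)] by simp
  qed
  finally show ?thesis
    using assms(2) by simp
qed

section \<open>Vanishing of an object whose projections vanish\<close>

text \<open>Multiplication by \<open>phase p (s * m)\<close> shifts the exponents from
  \<open>-m..m\<close> to \<open>0..n-1\<close> and gives a polynomial in \<open>phase p s\<close>
  of degree below \<open>n\<close>. By injectivity of \<open>phase p\<close> on \<open>S\<close> it
  has at least \<open>n\<close> roots.\<close>

lemma exponential_sum_coeffs_zero:
  fixes a :: "int \<Rightarrow> complex"
  assumes "odd n" "p > 0" "n \<le> card S"
    and near: "\<And>s t. s \<in> S \<Longrightarrow> t \<in> S \<Longrightarrow> \<bar>s - t\<bar> < real p"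
    and zero: "\<And>s. s \<in> S \<Longrightarrow> (\<Sum>i\<in>centered_ints n. a i * phase p (s * of_int i)) = 0"
    and "i \<in> centered_ints n"
  shows "a i = 0"
proof -
  obtain m where n: "n = 2 * m + 1"
    using assms(1) oddE by blast
  define q where "q = (\<Sum>k<n. monom (a (int k - int m)) k)"
  have coeff_q: "coeff q k = (if k < n then a (int k - int m) else 0)" for k
    by (simp add: q_def coeff_sum)
  have root: "poly q (phase p s) = 0" if "s \<in> S" for s
  proof -
    have "poly q (phase p s) = (\<Sum>k<n. a (int k - int m) * phase p s ^ k)"
      by (simp add: q_def poly_sum poly_monom)
    also have "\<dots> = phase p (s * real m) *
        (\<Sum>k<n. a (int k - int m) * phase p (s * of_int (int k - int m)))"
      unfolding sum_distrib_left
      by (rule sum.cong[OF refl])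
        (simp add: mult.left_commute flip: phase_of_nat_mult phase_add,
         simp add: algebra_simps)
    also have "\<dots> = 0"
      using zero[OF that] unfolding n sum_centered_ints by simp
    finally show ?thesis .
  qed
  have "q = 0"
  proof (rule ccontr)
    assume q: "q \<noteq> 0"
    have "degree q < n"
      using q coeff_q leading_coeff_neq_0 by metis
    have "card S = card (phase p ` S)"
      using inj_on_phase[OF assms(2) near] by (simp add: card_image)
    also have "\<dots> \<le> card {x. poly q x = 0}"
      using root poly_roots_finite[OF q] by (intro card_mono) auto
    also have "\<dots> \<le> degree q"
      by (rule card_poly_roots_bound[OF q])
    finally show False
      using \<open>degree q < n\<close> assms(3) by simp
  qed
  moreover have "a i = coeff q (nat (i + int m))"
    using assms(6) unfolding coeff_q n centered_ints_odd by auto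
  ultimately show ?thesis by simp
qed

text \<open>Only two kernels occur in the projections because at an integer first coordinate the
  third is a Kronecker delta. The proof passes from the double transform \<open>H\<close> to the
  single transform \<open>G\<close> and then to \<open>h\<close>, counting roots each time.\<close>

lemma slice_projections_zero_imp_zero:
  fixes h :: "int \<Rightarrow> int \<Rightarrow> int \<Rightarrow> complex"
  assumes "odd n" and p: "p = padded n"
    and bound: "\<And>l. l \<in> {1..n} \<Longrightarrow> \<bar>\<alpha> l\<bar> < 1 \<and> \<bar>\<beta> l\<bar> < 1"
    and card: "\<And>\<xi> \<eta>. \<xi> \<in> centered_ints p \<Longrightarrow> \<eta> \<in> centered_ints p \<Longrightarrow> (\<xi>, \<eta>) \<noteq> (0, 0) \<Longrightarrow>
      card {\<alpha> l * of_int \<xi> + \<beta> l * of_int \<eta> | l. l \<in> {1..n}} = n"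
    and proj: "\<And>l c\<^sub>1 c\<^sub>2. l \<in> {1..n} \<Longrightarrow> c\<^sub>1 \<in> centered_ints p \<Longrightarrow> c\<^sub>2 \<in> centered_ints p \<Longrightarrow>
      (\<Sum>i\<in>centered_ints n. \<Sum>j\<in>centered_ints n. \<Sum>k\<in>centered_ints n.
         h i j k * dirichlet_kernel p (\<alpha> l * of_int i + of_int c\<^sub>1 - of_int j)
                 * dirichlet_kernel p (\<beta> l * of_int i + of_int c\<^sub>2 - of_int k)) = 0"
    and ijk: "i \<in> centered_ints n" "j \<in> centered_ints n" "k \<in> centered_ints n"
  shows "h i j k = 0"
proof -
  obtain m where n: "n = 2 * m + 1"
    using assms(1) oddE by blast
  have pm: "p = 2 * (2 * m) + 1"
    by (simp add: p n padded_def)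
  then have "p > 0" "odd p" by simp_all
  let ?C = "centered_ints n" and ?P = "centered_ints p"
  define H where "H \<xi> \<eta> i = (\<Sum>j\<in>?C. \<Sum>k\<in>?C.
    h i j k * phase p (- of_int (\<xi> * j)) * phase p (- of_int (\<eta> * k)))" for \<xi> \<eta> i
  have central: "(\<Sum>i\<in>?C. H \<xi> \<eta> i * phase p ((\<alpha> l * of_int \<xi> + \<beta> l * of_int \<eta>) * of_int i)) = 0"
    if l: "l \<in> {1..n}" and \<xi>: "\<xi> \<in> ?P" and \<eta>: "\<eta> \<in> ?P" for l \<xi> \<eta>
  proof -
    let ?D = "dirichlet_kernel p"
    \<comment> \<open>The zero data are multiplied by characters and summed over the detector, so
      that each kernel sum becomes a phase.\<close>
    have "0 = (\<Sum>c\<^sub>1\<in>?P. \<Sum>c\<^sub>2\<in>?P. (\<Sum>i\<in>?C. \<Sum>j\<in>?C. \<Sum>k\<in>?C.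
         h i j k * ?D (\<alpha> l * of_int i + of_int c\<^sub>1 - of_int j)
                 * ?D (\<beta> l * of_int i + of_int c\<^sub>2 - of_int k))
         * phase p (- of_int (\<xi> * c\<^sub>1)) * phase p (- of_int (\<eta> * c\<^sub>2)))"
      using proj[OF l] by simp
    also have "\<dots> = (\<Sum>c\<^sub>1\<in>?P. \<Sum>c\<^sub>2\<in>?P. \<Sum>i\<in>?C. \<Sum>j\<in>?C. \<Sum>k\<in>?C. h i j k
         * (?D ((\<alpha> l * of_int i - of_int j) + of_int c\<^sub>1) * phase p (- of_int (\<xi> * c\<^sub>1)))
         * (?D ((\<beta> l * of_int i - of_int k) + of_int c\<^sub>2) * phase p (- of_int (\<eta> * c\<^sub>2))))"
      unfolding sum_distrib_right by (intro sum.cong refl) (simp add: algebra_simps)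
    also have "\<dots> = (\<Sum>i\<in>?C. \<Sum>j\<in>?C. \<Sum>k\<in>?C. \<Sum>c\<^sub>1\<in>?P. \<Sum>c\<^sub>2\<in>?P. h i j k
         * (?D ((\<alpha> l * of_int i - of_int j) + of_int c\<^sub>1) * phase p (- of_int (\<xi> * c\<^sub>1)))
         * (?D ((\<beta> l * of_int i - of_int k) + of_int c\<^sub>2) * phase p (- of_int (\<eta> * c\<^sub>2))))"
      by (simp only: sum.swap[of _ ?C ?P])
    also have "\<dots> = (\<Sum>i\<in>?C. \<Sum>j\<in>?C. \<Sum>k\<in>?C. h i j k
         * (\<Sum>c\<^sub>1\<in>?P. ?D ((\<alpha> l * of_int i - of_int j) + of_int c\<^sub>1) * phase p (- of_int (\<xi> * c\<^sub>1)))
         * (\<Sum>c\<^sub>2\<in>?P. ?D ((\<beta> l * of_int i - of_int k) + of_int c\<^sub>2) * phase p (- of_int (\<eta> * c\<^sub>2))))"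
      unfolding mult.assoc sum_product by (simp only: sum_distrib_left)
    also have "\<dots> = (\<Sum>i\<in>?C. \<Sum>j\<in>?C. \<Sum>k\<in>?C. h i j k
         * phase p (of_int \<xi> * (\<alpha> l * of_int i - of_int j))
         * phase p (of_int \<eta> * (\<beta> l * of_int i - of_int k)))"
      by (simp only: dft_dirichlet_kernel[OF \<open>odd p\<close> \<xi>] dft_dirichlet_kernel[OF \<open>odd p\<close> \<eta>])
    also have "\<dots> =
        (\<Sum>i\<in>?C. H \<xi> \<eta> i * phase p ((\<alpha> l * of_int \<xi> + \<beta> l * of_int \<eta>) * of_int i))"
      unfolding H_def sum_distrib_right
      by (intro sum.cong refl)
        (simp add: mult.assoc flip: phase_add, simp add: algebra_simps)
    finally show ?thesis by simp
  qed
  have H_zero: "H \<xi> \<eta> i = 0"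
    if le: "\<bar>\<xi>\<bar> + \<bar>\<eta>\<bar> \<le> 2 * int m" and nz: "(\<xi>, \<eta>) \<noteq> (0, 0)" for \<xi> \<eta>
  proof (rule exponential_sum_coeffs_zero[OF \<open>odd n\<close> \<open>p > 0\<close> _ _ _ ijk(1)])
    let ?S = "{\<alpha> l * of_int \<xi> + \<beta> l * of_int \<eta> | l. l \<in> {1..n}}"
    have P: "\<xi> \<in> ?P" "\<eta> \<in> ?P"
      using le unfolding pm centered_ints_odd by auto
    show "n \<le> card ?S"
      using card[OF P nz] by simp
    \<comment> \<open>Differences of nodes are then at most \<open>4 * m\<close>, just below
      \<open>p = 4 * m + 1\<close>.\<close>
    have small: "\<bar>s\<bar> \<le> 2 * real m" if mem: "s \<in> ?S" for s
    proof -
      obtain l where l: "l \<in> {1..n}" and s: "s = \<alpha> l * of_int \<xi> + \<beta> l * of_int \<eta>"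
        using mem by blast
      have "\<bar>s\<bar> \<le> \<bar>\<alpha> l\<bar> * \<bar>of_int \<xi>\<bar> + \<bar>\<beta> l\<bar> * \<bar>of_int \<eta>\<bar>"
        unfolding s by (metis abs_mult abs_triangle_ineq)
      also have "\<dots> \<le> 1 * \<bar>of_int \<xi>\<bar> + 1 * \<bar>of_int \<eta>\<bar>"
        using bound[OF l] by (intro add_mono mult_right_mono) auto
      also have "\<dots> \<le> 2 * real m"
        using le by linarith
      finally show ?thesis .
    qed
    show "\<bar>s - t\<bar> < real p" if "s \<in> ?S" "t \<in> ?S" for s t
      using small[OF that(1)] small[OF that(2)] unfolding pm by simp
    show "(\<Sum>i\<in>?C. H \<xi> \<eta> i * phase p (s * of_int i)) = 0" if "s \<in> ?S" for s
      using that central[OF _ P] by blast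
  qed
  show ?thesis
  proof (cases "m = 0")
    \<comment> \<open>Here the origin is the only frequency, and \<open>H_zero\<close> excludes it;
      \<open>central\<close> at the origin already says that the single value of \<open>h\<close> is
      zero.\<close>
    case True
    then have "?C = {0}" "?P = {0}"
      by (simp_all only: n pm centered_ints_odd) simp_all
    with central[of 1 0 0] ijk show ?thesis
      by (simp add: H_def n)
  next
    case False
    \<comment> \<open>\<open>G\<close> transforms the variable \<open>j\<close> only, so
      \<open>H\<close> is its transform in \<open>k\<close>.\<close>
    define G where "G \<xi> k = (\<Sum>j\<in>?C. h i j k * phase p (- of_int (\<xi> * j)))" for \<xi> k
    have H_G: "H \<xi> \<eta> i = (\<Sum>k\<in>?C. G \<xi> k * phase p (- of_int \<eta> * of_int k))" for \<xi> \<eta>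
      unfolding H_def G_def sum_distrib_right by (subst sum.swap) simp
    have G_zero: "G \<xi> k = 0" if "\<bar>\<xi>\<bar> \<le> int m" for \<xi>
    proof -
      \<comment> \<open>\<open>R\<close> is a row of frequencies on which \<open>H_zero\<close>
        applies. For \<open>\<xi> = 0\<close> the origin has to be left out, and the longer range
        makes up for it: \<open>4 * m\<close> points are at least \<open>n = 2 * m + 1\<close> once
        \<open>m > 0\<close>.\<close>
      define R where "R = (if \<xi> = 0 then {- 2 * int m..2 * int m} - {0} else {- int m..int m})"
      have R: "\<bar>\<xi>\<bar> + \<bar>\<eta>\<bar> \<le> 2 * int m" "(\<xi>, \<eta>) \<noteq> (0, 0)" if "\<eta> \<in> R" for \<eta>
        using that \<open>\<bar>\<xi>\<bar> \<le> int m\<close> by (auto simp: R_def split: if_splits)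
      show ?thesis
      proof (rule exponential_sum_coeffs_zero[OF \<open>odd n\<close> \<open>p > 0\<close> _ _ _ ijk(3)])
        \<comment> \<open>The minus sign matches the characters \<open>phase p (- \<eta> k)\<close>
          of the transform.\<close>
        let ?S = "(\<lambda>\<eta>. - real_of_int \<eta>) ` R"
        have "card ?S = card R"
          by (rule card_image) (simp add: inj_on_def)
        also have "n \<le> card R"
          using False by (cases "\<xi> = 0") (auto simp: R_def n nat_add_distrib nat_mult_distrib)
        finally show "n \<le> card ?S" .
        show "\<bar>s - t\<bar> < real p" if "s \<in> ?S" "t \<in> ?S" for s t
        proof -
          have small: "\<bar>r\<bar> \<le> 2 * real m" if "r \<in> ?S" for r
            using that R(1) by fastforce
          show ?thesis
            using small[OF that(1)] small[OF that(2)] unfolding pm by simp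
        qed
        show "(\<Sum>k\<in>?C. G \<xi> k * phase p (s * of_int k)) = 0" if "s \<in> ?S" for s
          using that H_zero[OF R] H_G by auto
      qed
    qed
    show ?thesis
    proof (rule exponential_sum_coeffs_zero[OF \<open>odd n\<close> \<open>p > 0\<close> _ _ _ ijk(2)])
      \<comment> \<open>\<open>G_zero\<close> holds on all of \<open>?C\<close>, which gives exactly
        \<open>n\<close> nodes with differences at most \<open>2 * m\<close>.\<close>
      let ?S = "(\<lambda>\<xi>. - real_of_int \<xi>) ` ?C"
      have "card ?S = card ?C"
        by (rule card_image) (simp add: inj_on_def)
      also have "n \<le> \<dots>"
        unfolding n centered_ints_odd by simp
      finally show "n \<le> card ?S" .
      show "\<bar>s - t\<bar> < real p" if "s \<in> ?S" "t \<in> ?S" for s t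
        using that unfolding pm n centered_ints_odd by auto
      show "(\<Sum>j\<in>?C. h i j k * phase p (s * of_int j)) = 0" if s: "s \<in> ?S" for s
      proof -
        obtain \<xi> where "\<xi> \<in> ?C" "s = - of_int \<xi>"
          using s by blast
        moreover from this have "\<bar>\<xi>\<bar> \<le> int m"
          unfolding n centered_ints_odd by auto
        ultimately show ?thesis
          using G_zero[of \<xi>] by (simp add: G_def)
      qed
    qed
  qed
qed

section \<open>Reduction of the three families of directions to one\<close>

lemma dirichlet_kernel_centered:
  assumes "odd n" "i \<in> centered_ints n" "j \<in> centered_ints n"
  shows "dirichlet_kernel (padded n) (of_int i - of_int j) = (if j = i then 1 else 0)"
proof -
  obtain m where n: "n = 2 * m + 1"
    using assms(1) oddE by blast
  have "odd (padded n)" "\<bar>i - j\<bar> < int (padded n)"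
    using assms(2,3) unfolding n centered_ints_odd padded_def by auto
  then show ?thesis
    using dirichlet_kernel_of_int[of "padded n" "i - j"] by simp
qed

text \<open>Differences of grid points are smaller than \<open>padded n\<close>, so the kernel in
  the first variable is a Kronecker delta and only the slice at \<open>i\<close> remains.\<close>

lemma interpolant_at_fst:
  assumes "odd n" "i \<in> centered_ints n"
  shows "interpolant n f (of_int i) y z =
    (\<Sum>j\<in>centered_ints n. \<Sum>k\<in>centered_ints n. f (i, j, k) *
       dirichlet_kernel (padded n) (y - of_int j) * dirichlet_kernel (padded n) (z - of_int k))"
proof -
  have "interpolant n f (of_int i) y z =
    (\<Sum>i'\<in>centered_ints n. if i' = i then \<Sum>j\<in>centered_ints n. \<Sum>k\<in>centered_ints n. f (i', j, k) *
       dirichlet_kernel (padded n) (y - of_int j) * dirichlet_kernel (padded n) (z - of_int k) else 0)"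
    unfolding interpolant_def
    by (rule sum.cong) (auto simp: dirichlet_kernel_centered[OF assms])
  then show ?thesis
    using assms(2) by simp
qed

text \<open>With the second coordinate moved to the front, a direction
  \<open>(\<alpha>, 1, \<beta>)\<close> takes the form
  \<open>(1, \<alpha>, \<beta>)\<close>.\<close>

lemma interpolant_swap:
  "interpolant n f x y z = interpolant n (\<lambda>(b, a, c). f (a, b, c)) y x z"
  unfolding interpolant_def by (subst sum.swap) (simp add: mult_ac)

text \<open>For directions \<open>(\<alpha>, \<beta>, 1)\<close>: the cyclic shift puts the third
  coordinate first and keeps the order of the other two, hence that of the detector
  variables.\<close>

lemma interpolant_rotate:
  "interpolant n f x y z = interpolant n (\<lambda>(c, a, b). f (a, b, c)) z x y"
proof -
  let ?C = "centered_ints n"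
  have "interpolant n f x y z = (\<Sum>a\<in>?C. \<Sum>c\<in>?C. \<Sum>b\<in>?C. f (a, b, c)
      * dirichlet_kernel (padded n) (x - of_int a) * dirichlet_kernel (padded n) (y - of_int b)
      * dirichlet_kernel (padded n) (z - of_int c))"
    unfolding interpolant_def by (intro sum.cong refl sum.swap)
  also have "\<dots> = interpolant n (\<lambda>(c, a, b). f (a, b, c)) z x y"
    unfolding interpolant_def by (subst sum.swap) (simp add: mult_ac)
  finally show ?thesis .
qed

text \<open>Projections are linear in the object, so those of \<open>g - u f\<close> vanish.\<close>

lemma slice_projections_eq_imp_eq:
  assumes "odd n"
    and bound: "\<forall>l\<in>{1..n}. \<bar>\<alpha> l\<bar> < 1 \<and> \<bar>\<beta> l\<bar> < 1"
    and card: "\<forall>(\<xi>, \<eta>) \<in> centered_ints (padded n) \<times> centered_ints (padded n) - {(0, 0)}.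
           card {\<alpha> l * of_int \<xi> + \<beta> l * of_int \<eta> | l. l \<in> {1..n}} = n"
    and proj: "\<And>l c\<^sub>1 c\<^sub>2. l \<in> {1..n} \<Longrightarrow> (c\<^sub>1, c\<^sub>2) \<in> detector_grid n \<Longrightarrow>
      (\<Sum>i\<in>centered_ints n.
         interpolant n g (of_int i) (\<alpha> l * of_int i + of_int c\<^sub>1) (\<beta> l * of_int i + of_int c\<^sub>2)) =
      u * (\<Sum>i\<in>centered_ints n.
         interpolant n f (of_int i) (\<alpha> l * of_int i + of_int c\<^sub>1) (\<beta> l * of_int i + of_int c\<^sub>2))"
    and ijk: "i \<in> centered_ints n" "j \<in> centered_ints n" "k \<in> centered_ints n"
  shows "g (i, j, k) = u * f (i, j, k)"
proof -
  have "g (i, j, k) - u * f (i, j, k) = 0"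
  proof (rule slice_projections_zero_imp_zero[OF \<open>odd n\<close> refl _ _ _ ijk])
    fix l c\<^sub>1 c\<^sub>2
    assume "l \<in> {1..n}" "c\<^sub>1 \<in> centered_ints (padded n)" "c\<^sub>2 \<in> centered_ints (padded n)"
    then show "(\<Sum>i\<in>centered_ints n. \<Sum>j\<in>centered_ints n. \<Sum>k\<in>centered_ints n.
         (g (i, j, k) - u * f (i, j, k))
         * dirichlet_kernel (padded n) (\<alpha> l * of_int i + of_int c\<^sub>1 - of_int j)
         * dirichlet_kernel (padded n) (\<beta> l * of_int i + of_int c\<^sub>2 - of_int k)) = 0"
      using proj[of l c\<^sub>1 c\<^sub>2]
      by (simp add: detector_grid_def interpolant_at_fst[OF \<open>odd n\<close>] sum_distrib_left
          left_diff_distrib sum_subtractf mult.assoc)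
  qed (use bound card in auto)
  then show ?thesis by simp
qed

theorem theorem5p1:
  fixes n :: nat
    and f g :: "int \<times> int \<times> int \<Rightarrow> complex"
    and \<alpha> \<beta> :: "nat \<Rightarrow> real"
    and \<T> :: "(real \<times> real \<times> real) set"
    and \<theta>\<^sub>0 :: real
  assumes "n > 0" and "odd n"
    and "f \<in> objects n" and "g \<in> objects n"
    and "\<T> = {(1, \<alpha> l, \<beta> l) | l. l \<in> {1..n}} \<or>
         \<T> = {(\<alpha> l, 1, \<beta> l) | l. l \<in> {1..n}} \<or>
         \<T> = {(\<alpha> l, \<beta> l, 1) | l. l \<in> {1..n}}"
    and "\<forall>l\<in>{1..n}. \<bar>\<alpha> l\<bar> < 1 \<and> \<bar>\<beta> l\<bar> < 1"
    and "\<forall>(\<xi>, \<eta>) \<in> centered_ints (padded n) \<times> centered_ints (padded n) - {(0, 0)}.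
           card {\<alpha> l * of_int \<xi> + \<beta> l * of_int \<eta> | l. l \<in> {1..n}} = n"
    and "\<forall>t\<in>\<T>. discrete_projection n g t =
           (\<lambda>c\<in>detector_grid n. exp (\<i> * of_real \<theta>\<^sub>0) * discrete_projection n f t c)"
  shows "g = (\<lambda>v\<in>cube n. exp (\<i> * of_real \<theta>\<^sub>0) * f v)"
proof -
  define u where "u = exp (\<i> * of_real \<theta>\<^sub>0)"
  have proj: "discrete_projection n g t c = u * discrete_projection n f t c"
    if "t \<in> \<T>" "c \<in> detector_grid n" for t c
    using assms(8) that by (simp add: u_def)
  note core = slice_projections_eq_imp_eq[OF assms(2,6,7)]
  \<comment> \<open>These facts make the case distinction in \<open>discrete_projection\<close>
    select the branch of the intended family.\<close>
  have ne: "\<alpha> l \<noteq> 1" "\<beta> l \<noteq> 1" "\<bar>\<alpha> l\<bar> < 1" "\<bar>\<beta> l\<bar> < 1" if "l \<in> {1..n}" for l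
    using assms(6) that by force+
  have eq: "g (i, j, k) = u * f (i, j, k)"
    if ijk: "i \<in> centered_ints n" "j \<in> centered_ints n" "k \<in> centered_ints n" for i j k
    using assms(5)
  proof (elim disjE)
    assume T: "\<T> = {(1, \<alpha> l, \<beta> l) | l. l \<in> {1..n}}"
    show ?thesis
    proof (rule core[OF _ ijk])
      fix l c\<^sub>1 c\<^sub>2 assume l: "l \<in> {1..n}" and c: "(c\<^sub>1, c\<^sub>2) \<in> detector_grid n"
      have "(1, \<alpha> l, \<beta> l) \<in> \<T>" using T l by blast
      from proj[OF this c] c ne[OF l]
      show "(\<Sum>i\<in>centered_ints n. interpolant n g (of_int i)
          (\<alpha> l * of_int i + of_int c\<^sub>1) (\<beta> l * of_int i + of_int c\<^sub>2)) =
        u * (\<Sum>i\<in>centered_ints n. interpolant n f (of_int i)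
          (\<alpha> l * of_int i + of_int c\<^sub>1) (\<beta> l * of_int i + of_int c\<^sub>2))"
        by (simp add: discrete_projection_def)
    qed
  next
    assume T: "\<T> = {(\<alpha> l, 1, \<beta> l) | l. l \<in> {1..n}}"
    let ?s = "\<lambda>F. \<lambda>(b, a, c). F (a, b, c) :: complex"
    have "?s g (j, i, k) = u * ?s f (j, i, k)"
    proof (rule core[OF _ ijk(2,1,3)])
      fix l c\<^sub>1 c\<^sub>2 assume l: "l \<in> {1..n}" and c: "(c\<^sub>1, c\<^sub>2) \<in> detector_grid n"
      have "(\<alpha> l, 1, \<beta> l) \<in> \<T>" using T l by blast
      from proj[OF this c] c ne[OF l]
      show "(\<Sum>i\<in>centered_ints n. interpolant n (?s g) (of_int i)
          (\<alpha> l * of_int i + of_int c\<^sub>1) (\<beta> l * of_int i + of_int c\<^sub>2)) =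
        u * (\<Sum>i\<in>centered_ints n. interpolant n (?s f) (of_int i)
          (\<alpha> l * of_int i + of_int c\<^sub>1) (\<beta> l * of_int i + of_int c\<^sub>2))"
        by (simp add: discrete_projection_def flip: interpolant_swap)
    qed
    then show ?thesis by simp
  next
    assume T: "\<T> = {(\<alpha> l, \<beta> l, 1) | l. l \<in> {1..n}}"
    let ?s = "\<lambda>F. \<lambda>(c, a, b). F (a, b, c) :: complex"
    have "?s g (k, i, j) = u * ?s f (k, i, j)"
    proof (rule core[OF _ ijk(3,1,2)])
      fix l c\<^sub>1 c\<^sub>2 assume l: "l \<in> {1..n}" and c: "(c\<^sub>1, c\<^sub>2) \<in> detector_grid n"
      have "(\<alpha> l, \<beta> l, 1) \<in> \<T>" using T l by blast
      from proj[OF this c] c ne[OF l]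
      show "(\<Sum>i\<in>centered_ints n. interpolant n (?s g) (of_int i)
          (\<alpha> l * of_int i + of_int c\<^sub>1) (\<beta> l * of_int i + of_int c\<^sub>2)) =
        u * (\<Sum>i\<in>centered_ints n. interpolant n (?s f) (of_int i)
          (\<alpha> l * of_int i + of_int c\<^sub>1) (\<beta> l * of_int i + of_int c\<^sub>2))"
        by (simp add: discrete_projection_def flip: interpolant_rotate)
    qed
    then show ?thesis by simp
  qed
  show ?thesis
  proof
    fix v
    show "g v = (\<lambda>v\<in>cube n. exp (\<i> * of_real \<theta>\<^sub>0) * f v) v"
    proof (cases "v \<in> cube n")
      case True
      then show ?thesis
        using eq by (auto simp: cube_def u_def)
    next
      \<comment> \<open>Off the cube both sides are \<open>undefined\<close>, since \<open>g\<close>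
        is extensional.\<close>
      case False
      then show ?thesis
        using assms(4) PiE_arb[of g "cube n" "\<lambda>_. UNIV" v] by (simp add: objects_def)
    qed
  qed
qed

end
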